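(* Let $\mathbb{F}$ be a field, let $W(t)=\sum_{n=0}^\infty\frac{t^n}{w_n}\in\mathbb{F}[[t]]$ with $w_0=1$ and $w_n\neq0$ for all $n$, and let $A\in R_W$ be the matrix representing a $W$-Appell sequence with parameter $\alpha(y)=\sum_{n=0}^\infty c_ny^n\in\mathbb{F}[[y]]$, where $c_0\neq0$. Let $\widetilde{W}(t)=\sum_{n=0}^\infty\frac{t^n}{\widetilde{w}_n}\in\mathbb{F}[[t]]$ with $\widetilde{w}_0=1$ and $\widetilde{w}_n\neq0$ for all $n$, and put $\gamma_k=\frac{\widetilde{w}_kw_{k+1}}{\widetilde{w}_{k+1}w_k}$ for $k\in\mathbb{N}$. Then $A\in R_{\widetilde{W}}$ in each of the following two cases: (i) $\gamma_k$ is a non-zero constant, independent of $k$. (ii) $\mathbb{F}$ has characteristic $0$, $\gamma_k$ is a non-constant, never vanishing linear function of $k$ (i.e. $\gamma_k=\lambda-\sigma k\neq 0$ for all $k\in\mathbb{N}$, for some $\lambda,\sigma\in\mathbb{F}$ with $\sigma\neq0$), and $\alpha(y)=c_0e^{hy}$ for some $h\in\mathbb{F}$. Conversely, if $c_1\neq0$, then $A\in R_{\widetilde{W}}$ only if one of the conditions (i) or (ii) is satisfied.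
   Context: $\mathbb{N}=\{0,1,2,\dots\}$. $L$ is the group of infinite lower triangular matrices $(a_{n,k})_{n,k\in\mathbb{N}}$ over $\mathbb{F}$ with non-zero diagonal entries; $A\in L$ represents the graded sequence $p_n(x)=\sum_{k=0}^na_{n,k}x^k$. For a weight $W(t)=\sum_n t^n/w_n$ as in the statement, $R_W$ is the set of $W$-Riordan arrays: those $A\in L$ such that, with $C_k(y)=\sum_{n=0}^\infty a_{n,k}\frac{y^n}{w_n}$, the quotient $\frac{w_{k+1}C_{k+1}}{w_kC_k}$ is independent of $k$; $R_{\widetilde{W}}$ is defined in the same way with $\widetilde{w}_n$ in place of $w_n$. The graded sequence $\{p_n\}$ is $W$-Appell if the linear operator on $\mathbb{F}[x]$ sending $\frac{p_n}{w_n}$ to $\frac{p_{n-1}}{w_{n-1}}$ for $n\ge1$ and $p_0$ to $0$ coincides with the operator $D_W$ sending $\frac{x^n}{w_n}$ to $\frac{x^{n-1}}{w_{n-1}}$ for $n\geq1$ and $1$ to $0$. Its parameter is $\alpha(y)=C_0(y)=\sum_{n=0}^\infty p_n(0)\frac{y^n}{w_n}$, and one has $\sum_{n=0}^\infty p_n(x)\frac{y^n}{w_n}=\alpha(y)W(xy)$. *)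

theory Defs
  imports "HOL-Computational_Algebra.Computational_Algebra"
begin

text \<open>
  A weight is a power series with all coefficients nonzero, written as the sum of \<open>t^n / w_n\<close>;
  \<open>weight_coeff W n\<close> is this \<open>w_n\<close>, the reciprocal of the coefficient of \<open>t^n\<close>.
\<close>

definition weight_coeff :: "'a::field fps \<Rightarrow> nat \<Rightarrow> 'a" where
  "weight_coeff W n = 1 / fps_nth W n"

definition lower_triangular_group :: "(nat \<Rightarrow> nat \<Rightarrow> 'a::field) set" where
  "lower_triangular_group = {A. (\<forall>n k. n < k \<longrightarrow> A n k = 0) \<and> (\<forall>n. A n n \<noteq> 0)}"

definition graded_sequence :: "(nat \<Rightarrow> nat \<Rightarrow> 'a::field) \<Rightarrow> nat \<Rightarrow> 'a poly" where
  "graded_sequence A n = (\<Sum>k\<le>n. monom (A n k) k)"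

definition column_series :: "'a::field fps \<Rightarrow> (nat \<Rightarrow> nat \<Rightarrow> 'a) \<Rightarrow> nat \<Rightarrow> 'a fps" where
  "column_series W A k = Abs_fps (\<lambda>n. A n k / weight_coeff W n)"

text \<open>
  For \<open>A\<close> in \<open>lower_triangular_group\<close> and a weight \<open>W\<close>, the \<open>k\<close>-th column series has order
  exactly \<open>k\<close>, so the division of power series below is exact.
\<close>

definition riordan_arrays :: "'a::field fps \<Rightarrow> (nat \<Rightarrow> nat \<Rightarrow> 'a) set" where
  "riordan_arrays W = {A \<in> lower_triangular_group.
     \<exists>q. \<forall>k. (fps_const (weight_coeff W (Suc k)) * column_series W A (Suc k)) /
             (fps_const (weight_coeff W k) * column_series W A k) = q}"

definition lowering_operator ::
  "'a::field fps \<Rightarrow> (nat \<Rightarrow> 'a poly) \<Rightarrow> ('a poly \<Rightarrow> 'a poly) \<Rightarrow> bool" where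
  "lowering_operator W p T \<longleftrightarrow>
     Vector_Spaces.linear smult smult T \<and>
     T (p 0) = 0 \<and>
     (\<forall>n. T (smult (1 / weight_coeff W (Suc n)) (p (Suc n))) = smult (1 / weight_coeff W n) (p n))"

text \<open>
  A graded sequence is a basis of the polynomials, so its lowering operator exists and is unique.
  The lowering operator of the monomials is the \<open>W\<close>-derivative, and the definition says that
  the two operators coincide.
\<close>

definition W_appell :: "'a::field fps \<Rightarrow> (nat \<Rightarrow> 'a poly) \<Rightarrow> bool" where
  "W_appell W p \<longleftrightarrow>
     (\<exists>D. lowering_operator W (\<lambda>n. monom 1 n) D \<and> lowering_operator W p D)"

definition appell_parameter :: "'a::field fps \<Rightarrow> (nat \<Rightarrow> 'a poly) \<Rightarrow> 'a fps" where
  "appell_parameter W p = Abs_fps (\<lambda>n. poly (p n) 0 / weight_coeff W n)"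

end

theory Submission
  imports Defs
begin

text \<open>
  An Appell array is built from its parameter: its entries are \<open>w\<^sub>n c\<^sub>n\<^sub>-\<^sub>k / w\<^sub>k\<close>.  Reading
  them with the second weight, the \<open>k\<close>-th normalised column becomes \<open>y\<^sup>k F\<^sub>k(y)\<close> where
  \<open>F\<^sub>k(y) = \<Sum>\<^sub>m \<gamma>\<^sub>k \<gamma>\<^sub>k\<^sub>+\<^sub>1 \<dots> \<gamma>\<^sub>k\<^sub>+\<^sub>m\<^sub>-\<^sub>1 c\<^sub>m y\<^sup>m\<close>, because \<open>\<gamma>\<close> is the sequence of successive quotients
  of \<open>w\<^sub>n / w'\<^sub>n\<close>.  So the array is Riordan for the second weight exactly when
  \<open>F\<^sub>k\<^sub>+\<^sub>1 = g F\<^sub>k\<close> for one series \<open>g\<close> (\<open>riordan_iff_twisted_ratio\<close>), and everything else is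
  about this recurrence.

  If \<open>\<gamma>\<close> is constant, all \<open>F\<^sub>k\<close> agree.  If \<open>\<gamma>\<^sub>k = l - s k\<close> and \<open>\<alpha>\<close> is exponential, then \<open>F\<^sub>k\<close>
  is \<open>c\<^sub>0\<close> times the binomial series \<open>(1 + s h y)\<^sup>l\<^sup>/\<^sup>s\<^sup>-\<^sup>k\<close>, whence the quotient
  \<open>1 / (1 + s h y)\<close>.

  Conversely, the coefficients of \<open>y\<close> in \<open>F\<^sub>k\<^sub>+\<^sub>1 = g F\<^sub>k\<close> force \<open>\<gamma>\<close> to have constant
  differences.  A non-zero difference is impossible in characteristic \<open>p > 0\<close>: there \<open>\<gamma>\<close>, and
  hence \<open>F\<close>, has period \<open>p\<close>, so \<open>g\<^sup>p = 1\<close> and \<open>g = 1\<close>.  In characteristic zero each coefficient of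
  the recurrence is a polynomial identity in \<open>k\<close>, and its leading coefficient says that
  \<open>(n+1) c\<^sub>n\<^sub>+\<^sub>1\<close> is a fixed multiple of \<open>c\<^sub>n\<close>, so \<open>\<alpha>\<close> is exponential.
\<close>

section \<open>Entries of Appell arrays\<close>

lemma coeff_graded_sequence:
  assumes "A \<in> lower_triangular_group"
  shows "coeff (graded_sequence A n) k = A n k"
  using assms
  by (auto simp: graded_sequence_def coeff_sum lower_triangular_group_def)

lemma coeff_monomial_lowering_operator:
  fixes D :: "'a::field poly \<Rightarrow> 'a poly"
  assumes D: "lowering_operator W (\<lambda>n. monom 1 n) D"
    and W: "\<And>n. weight_coeff W n \<noteq> 0"
  shows "coeff (D p) k = coeff p (Suc k) * weight_coeff W (Suc k) / weight_coeff W k"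
proof -
  have lin: "Vector_Spaces.linear smult smult D"
    using D by (simp add: lowering_operator_def)
  interpret D: Vector_Spaces.linear smult smult D by (rule lin)
  have D0: "D (monom a 0) = 0" for a
    using D D.scale[of a "monom 1 0"] by (simp add: lowering_operator_def smult_monom monom_0)
  have DSuc: "D (monom a (Suc i)) = monom (a * weight_coeff W (Suc i) / weight_coeff W i) i" for a i
  proof -
    have "monom a (Suc i) =
        smult (a * weight_coeff W (Suc i)) (smult (1 / weight_coeff W (Suc i)) (monom 1 (Suc i)))"
      using W by (simp add: smult_monom)
    then have "D (monom a (Suc i)) =
        D (smult (a * weight_coeff W (Suc i)) (smult (1 / weight_coeff W (Suc i)) (monom 1 (Suc i))))"
      by (rule arg_cong)
    also have "\<dots> = smult (a * weight_coeff W (Suc i)) (smult (1 / weight_coeff W i) (monom 1 i))"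
      unfolding D.scale[of "a * weight_coeff W (Suc i)"]
      using D by (simp only: lowering_operator_def)
    finally show ?thesis by (simp add: smult_monom)
  qed
  have "D p = D (\<Sum>i\<le>Suc (k + degree p). monom (coeff p i) i)"
    by (subst poly_as_sum_of_monoms') auto
  also have "\<dots> = (\<Sum>i\<le>Suc (k + degree p). D (monom (coeff p i) i))"
    by (rule D.sum)
  also have "\<dots> = (\<Sum>i\<le>k + degree p.
      monom (coeff p (Suc i) * weight_coeff W (Suc i) / weight_coeff W i) i)"
    by (simp only: sum.atMost_Suc_shift D0 DSuc) simp
  finally show ?thesis by (simp add: coeff_sum)
qed

text \<open>
  Comparing coefficients in \<open>D (p\<^sub>n\<^sub>+\<^sub>1 / w\<^sub>n\<^sub>+\<^sub>1) = p\<^sub>n / w\<^sub>n\<close> shows that \<open>a\<^sub>n\<^sub>,\<^sub>k w\<^sub>k / w\<^sub>n\<close> is constant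
  along the diagonals, so it can be read off in the column of constant terms.
\<close>

lemma W_appell_entry:
  fixes A :: "nat \<Rightarrow> nat \<Rightarrow> 'a::field"
  assumes app: "W_appell W (graded_sequence A)"
    and low: "A \<in> lower_triangular_group"
    and W: "\<And>n. weight_coeff W n \<noteq> 0" and W0: "weight_coeff W 0 = 1"
  shows "A (k + m) k = weight_coeff W (k + m) / weight_coeff W k *
           fps_nth (appell_parameter W (graded_sequence A)) m"
proof (induction k)
  case 0
  have "poly (graded_sequence A m) 0 = A m 0"
    by (simp add: poly_0_coeff_0 coeff_graded_sequence[OF low])
  then show ?case using W W0 by (simp add: appell_parameter_def)
next
  case (Suc k)
  obtain D where D: "lowering_operator W (\<lambda>n. monom 1 n) D"
      "lowering_operator W (graded_sequence A) D"
    using app by (auto simp: W_appell_def)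
  have "coeff (D (smult (1 / weight_coeff W (Suc (k + m))) (graded_sequence A (Suc (k + m))))) k
      = coeff (smult (1 / weight_coeff W (k + m)) (graded_sequence A (k + m))) k"
    using D(2) by (simp add: lowering_operator_def)
  then have "A (Suc (k + m)) (Suc k) * weight_coeff W (Suc k) /
        (weight_coeff W (Suc (k + m)) * weight_coeff W k) = A (k + m) k / weight_coeff W (k + m)"
    by (simp add: coeff_monomial_lowering_operator[OF D(1) W] coeff_graded_sequence[OF low]
        mult_ac)
  then have "A (Suc (k + m)) (Suc k) = A (k + m) k / weight_coeff W (k + m) *
       (weight_coeff W (Suc (k + m)) * weight_coeff W k) / weight_coeff W (Suc k)"
    using W by (simp add: divide_simps mult_ac)
  then show ?case using Suc.IH W by simp
qed

section \<open>Columns with respect to another weight\<close>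

definition twisted_series :: "(nat \<Rightarrow> 'a::field) \<Rightarrow> (nat \<Rightarrow> 'a) \<Rightarrow> nat \<Rightarrow> 'a fps" where
  "twisted_series \<gamma> c k = Abs_fps (\<lambda>m. (\<Prod>i<m. \<gamma> (k + i)) * c m)"

lemma twisted_series_nth [simp]:
  "fps_nth (twisted_series \<gamma> c k) m = (\<Prod>i<m. \<gamma> (k + i)) * c m"
  by (simp add: twisted_series_def)

lemma prod_successive_quotients:
  fixes u :: "nat \<Rightarrow> 'a::field"
  assumes "\<And>n. u n \<noteq> 0"
  shows "(\<Prod>i<m. u (Suc (k + i)) / u (k + i)) = u (k + m) / u k"
  using assms by (induction m) auto

text \<open>
  The \<open>F k\<close> are units, so the quotient is exactly \<open>X\<close> times \<open>F (k+1) / F k\<close>; \<open>X\<close> cancels.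
\<close>

lemma constant_ratio_shifted_iff:
  fixes F :: "nat \<Rightarrow> 'a::field fps"
  assumes "\<And>k. fps_nth (F k) 0 \<noteq> 0"
  shows "(\<exists>q. \<forall>k. (fps_X ^ Suc k * F (Suc k)) / (fps_X ^ k * F k) = q) \<longleftrightarrow>
         (\<exists>g. \<forall>k. F (Suc k) = g * F k)"
proof -
  have nz: "fps_X ^ k * F k \<noteq> 0" for k
    using assms[of k] by auto
  have unit: "inverse (F k) * F k = 1" for k
    using assms inverse_mult_eq_1 by blast
  have quot: "(fps_X ^ Suc k * F (Suc k)) / (fps_X ^ k * F k) = fps_X * (F (Suc k) * inverse (F k))"
    for k
  proof -
    have "fps_X ^ Suc k * F (Suc k) = fps_X ^ Suc k * (F (Suc k) * (inverse (F k) * F k))"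
      by (simp only: unit mult_1_right)
    also have "\<dots> = (fps_X * (F (Suc k) * inverse (F k))) * (fps_X ^ k * F k)"
      by (simp add: mult_ac)
    finally show ?thesis using nz by (metis nonzero_mult_div_cancel_right)
  qed
  have ratio: "F (Suc k) * inverse (F k) = g \<longleftrightarrow> F (Suc k) = g * F k" for k g
  proof
    assume "F (Suc k) * inverse (F k) = g"
    then have "g * F k = F (Suc k) * (inverse (F k) * F k)" by (simp add: mult.assoc)
    then show "F (Suc k) = g * F k" by (simp only: unit mult_1_right)
  next
    assume "F (Suc k) = g * F k"
    then have "F (Suc k) * inverse (F k) = g * (inverse (F k) * F k)" by (simp add: mult_ac)
    then show "F (Suc k) * inverse (F k) = g" by (simp only: unit mult_1_right)
  qed
  have "(\<exists>q. \<forall>k. fps_X * (F (Suc k) * inverse (F k)) = q) \<longleftrightarrow>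
      (\<exists>g. \<forall>k. F (Suc k) * inverse (F k) = g)"
  proof
    assume "\<exists>q. \<forall>k. fps_X * (F (Suc k) * inverse (F k)) = q"
    then obtain q where q: "\<And>k. fps_X * (F (Suc k) * inverse (F k)) = q"
      by blast
    have "F (Suc k) * inverse (F k) = F (Suc 0) * inverse (F 0)" for k
      using q[of k] q[of 0] by (metis mult_left_cancel fps_X_neq_zero)
    then show "\<exists>g. \<forall>k. F (Suc k) * inverse (F k) = g" by blast
  qed auto
  then show ?thesis
    unfolding quot ratio .
qed

text \<open>
  With \<open>u\<^sub>n = w\<^sub>n / w'\<^sub>n\<close>, the normalised column \<open>w'\<^sub>k C\<^sub>k\<close> has the coefficients
  \<open>(u\<^sub>k\<^sub>+\<^sub>m / u\<^sub>k) c\<^sub>m\<close> at \<open>y\<^sup>k\<^sup>+\<^sup>m\<close>, and \<open>u\<^sub>k\<^sub>+\<^sub>m / u\<^sub>k\<close> telescopes into a product of values of \<open>\<gamma>\<close>.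
\<close>

lemma riordan_iff_twisted_ratio:
  fixes A :: "nat \<Rightarrow> nat \<Rightarrow> 'a::field"
  assumes low: "A \<in> lower_triangular_group"
    and entry: "\<And>k m. A (k + m) k = w (k + m) / w k * c m"
    and w: "\<And>n. w n \<noteq> 0" and w': "\<And>n. weight_coeff W' n = w' n" "\<And>n. w' n \<noteq> 0"
    and \<gamma>: "\<And>k. \<gamma> k = (w' k * w (Suc k)) / (w' (Suc k) * w k)"
    and c0: "c 0 \<noteq> 0"
  shows "A \<in> riordan_arrays W' \<longleftrightarrow>
    (\<exists>g. \<forall>k. twisted_series \<gamma> c (Suc k) = g * twisted_series \<gamma> c k)"
proof -
  define u where "u n = w n / w' n" for n
  have u: "u n \<noteq> 0" for n using w w' by (simp add: u_def)
  have \<gamma>u: "\<gamma> k = u (Suc k) / u k" for k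
    using w w' by (simp add: \<gamma> u_def)
  have col: "fps_const (weight_coeff W' k) * column_series W' A k = fps_X ^ k * twisted_series \<gamma> c k"
    for k
  proof (rule fps_ext)
    fix n
    show "fps_nth (fps_const (weight_coeff W' k) * column_series W' A k) n
        = fps_nth (fps_X ^ k * twisted_series \<gamma> c k) n"
    proof (cases "n < k")
      case True
      then show ?thesis
        using low by (simp add: column_series_def fps_X_power_mult_nth lower_triangular_group_def)
    next
      case False
      then obtain m where m: "n = k + m" by (metis le_add_diff_inverse not_less)
      have "w' k * (A (k + m) k / w' (k + m)) = u (k + m) / u k * c m"
        by (simp add: entry u_def mult_ac)
      then show ?thesis
        using prod_successive_quotients[of u k m, OF u]
        by (simp add: m column_series_def fps_X_power_mult_nth w' \<gamma>u)
    qed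
  qed
  have "A \<in> riordan_arrays W' \<longleftrightarrow> (\<exists>q. \<forall>k. (fps_X ^ Suc k * twisted_series \<gamma> c (Suc k)) /
      (fps_X ^ k * twisted_series \<gamma> c k) = q)"
    using low by (simp only: riordan_arrays_def col mem_Collect_eq simp_thms)
  also have "\<dots> \<longleftrightarrow> (\<exists>g. \<forall>k. twisted_series \<gamma> c (Suc k) = g * twisted_series \<gamma> c k)"
    by (rule constant_ratio_shifted_iff) (simp add: c0)
  finally show ?thesis .
qed

section \<open>Sufficiency\<close>

text \<open>
  Up to the factor \<open>a\<close> and for \<open>s \<noteq> 0\<close>, the series are binomial series of exponent \<open>l/s - k\<close> in
  \<open>1 + s h y\<close>; coefficientwise the claim is Pascal's rule, which comes down to \<open>\<gamma>\<^sub>k = \<gamma>\<^sub>k\<^sub>+\<^sub>m + s m\<close>.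
\<close>

lemma twisted_series_exp_affine:
  fixes l s h a :: "'a::field"
  assumes char: "CHAR('a) = 0"
    and \<gamma>: "\<And>k. \<gamma> k = l - s * of_nat k"
    and c: "\<And>n. c n = a * (h ^ n / of_nat (fact n))"
  shows "twisted_series \<gamma> c k = (1 + fps_const (s * h) * fps_X) * twisted_series \<gamma> c (Suc k)"
proof (rule fps_ext)
  fix n
  show "fps_nth (twisted_series \<gamma> c k) n =
        fps_nth ((1 + fps_const (s * h) * fps_X) * twisted_series \<gamma> c (Suc k)) n"
  proof (cases n)
    case 0
    then show ?thesis by (simp add: distrib_right mult.assoc)
  next
    case (Suc m)
    define P where "P = (\<Prod>i<m. \<gamma> (Suc k + i))"
    have [simp]: "of_nat (fact j) \<noteq> (0::'a)" "of_nat (Suc j) \<noteq> (0::'a)" for j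
      using char by (simp_all only: of_nat_eq_0_iff_char_dvd) auto
    have left: "(\<Prod>i<Suc m. \<gamma> (k + i)) = \<gamma> k * P"
      unfolding prod.lessThan_Suc_shift P_def by simp
    have right: "(\<Prod>i<Suc m. \<gamma> (Suc k + i)) = P * \<gamma> (Suc k + m)"
      by (simp add: P_def)
    have step: "of_nat (Suc m) * c (Suc m) = h * c m"
      unfolding c fact_Suc of_nat_mult of_nat_id by (simp add: field_simps del: of_nat_Suc)
    have "\<gamma> k = \<gamma> (Suc k + m) + s * of_nat (Suc m)"
      by (simp add: \<gamma> algebra_simps)
    then have "\<gamma> k * P * c (Suc m) =
        P * \<gamma> (Suc k + m) * c (Suc m) + s * P * (of_nat (Suc m) * c (Suc m))"
      by (simp add: algebra_simps del: of_nat_Suc)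
    also have "\<dots> = P * \<gamma> (Suc k + m) * c (Suc m) + s * h * (P * c m)"
      unfolding step by simp
    finally show ?thesis
      unfolding Suc distrib_right fps_add_nth mult_1_left mult.assoc fps_mult_left_const_nth
        fps_mult_fps_X_commute twisted_series_nth left right
      by (simp add: P_def mult_ac)
  qed
qed

lemma affine_exp_imp_twisted_ratio:
  fixes l s h a :: "'a::field"
  assumes "CHAR('a) = 0"
    and "\<And>k. \<gamma> k = l - s * of_nat k"
    and "\<And>n. c n = a * (h ^ n / of_nat (fact n))"
  shows "\<exists>g. \<forall>k. twisted_series \<gamma> c (Suc k) = g * twisted_series \<gamma> c k"
proof -
  define b where "b = 1 + fps_const (s * h) * fps_X"
  have "fps_nth b 0 \<noteq> 0" by (simp add: b_def)
  then have "inverse b * b = 1" by (rule inverse_mult_eq_1)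
  moreover have "twisted_series \<gamma> c k = b * twisted_series \<gamma> c (Suc k)" for k
    unfolding b_def by (rule twisted_series_exp_affine[OF assms])
  ultimately have "twisted_series \<gamma> c (Suc k) = inverse b * twisted_series \<gamma> c k" for k
    by (metis mult.assoc mult_1_left)
  then show ?thesis by blast
qed

section \<open>Necessity\<close>

lemma affine_of_constant_difference:
  fixes \<gamma> :: "nat \<Rightarrow> 'a::field"
  assumes "\<And>k. \<gamma> (Suc k) = \<gamma> k - s"
  shows "\<gamma> k = \<gamma> 0 - s * of_nat k"
proof (induction k)
  case (Suc k)
  have "\<gamma> (Suc k) = (\<gamma> 0 - s * of_nat k) - s"
    by (subst assms) (simp add: Suc)
  then show ?case by (simp add: algebra_simps)
qed simp

lemma twisted_ratio_nth_0:
  fixes g :: "'a::field fps"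
  assumes "\<And>k. twisted_series \<gamma> c (Suc k) = g * twisted_series \<gamma> c k" and "c 0 \<noteq> 0"
  shows "fps_nth g 0 = 1"
  using arg_cong[OF assms(1), of "\<lambda>f. fps_nth f 0" 0] assms(2) by simp

lemma twisted_ratio_nth_1:
  fixes g :: "'a::field fps"
  assumes ratio: "\<And>k. twisted_series \<gamma> c (Suc k) = g * twisted_series \<gamma> c k" and c0: "c 0 \<noteq> 0"
  shows "(\<gamma> (Suc k) - \<gamma> k) * c 1 = fps_nth g 1 * c 0"
  using arg_cong[OF ratio, of "\<lambda>f. fps_nth f 1" k] twisted_ratio_nth_0[OF assms]
  by (simp add: fps_mult_nth_1 algebra_simps)

text \<open>
  In characteristic \<open>p\<close> the sequence \<open>\<gamma>\<close> has period \<open>p\<close>, hence so have the series and \<open>g\<^sup>p = 1\<close>.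
  The Frobenius map then gives \<open>(g - 1)\<^sup>p = 0\<close>.
\<close>

lemma twisted_ratio_prime_char:
  fixes g :: "'a::field fps"
  assumes ratio: "\<And>k. twisted_series \<gamma> c (Suc k) = g * twisted_series \<gamma> c k" and c0: "c 0 \<noteq> 0"
    and \<gamma>: "\<And>k. \<gamma> k = l - s * of_nat k"
    and char: "CHAR('a) > 0"
  shows "g = 1"
proof -
  define p where "p = CHAR('a fps)"
  have p: "prime p"
    unfolding p_def semiring_char_fps using char by (rule prime_CHAR_semidom)
  have iter: "twisted_series \<gamma> c n = g ^ n * twisted_series \<gamma> c 0" for n
    by (induction n) (simp_all add: ratio mult_ac)
  have "\<gamma> (p + i) = \<gamma> i" for i
    by (simp add: \<gamma> p_def)
  then have "twisted_series \<gamma> c p = twisted_series \<gamma> c 0"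
    by (simp add: twisted_series_def)
  then have "g ^ p * twisted_series \<gamma> c 0 = 1 * twisted_series \<gamma> c 0"
    using iter[of p] by simp
  moreover have "fps_nth (twisted_series \<gamma> c 0) 0 \<noteq> 0" using c0 by simp
  ultimately have "g ^ p = 1" by (metis mult_right_cancel fps_zero_nth)
  moreover have "((g - 1) + 1) ^ p = (g - 1) ^ p + 1 ^ p"
    unfolding p_def by (rule freshmans_dream) (use p in \<open>simp_all add: p_def\<close>)
  ultimately have "(g - 1) ^ p = 0" by simp
  then show ?thesis by simp
qed

text \<open>
  For \<open>\<gamma>\<^sub>k = l - s k\<close>, this is \<open>\<gamma>\<^sub>k \<dots> \<gamma>\<^sub>k\<^sub>+\<^sub>m\<^sub>-\<^sub>1\<close> as a polynomial in \<open>k\<close>; replacing \<open>l\<close> by \<open>l - s\<close> shifts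
  \<open>k\<close> by one.
\<close>

definition affine_product :: "'a::field \<Rightarrow> 'a \<Rightarrow> nat \<Rightarrow> 'a poly" where
  "affine_product l s m = (\<Prod>i<m. [:l - s * of_nat i, - s:])"

lemma poly_affine_product:
  "poly (affine_product l s m) (of_nat k) = (\<Prod>i<m. l - s * of_nat (k + i))"
  by (simp add: affine_product_def poly_prod algebra_simps)

lemma degree_affine_product_le: "degree (affine_product l s m) \<le> m"
proof (induction m)
  case (Suc m)
  have "affine_product l s (Suc m) = affine_product l s m * [:l - s * of_nat m, - s:]"
    by (simp add: affine_product_def)
  then show ?case
    using Suc degree_mult_le[of "affine_product l s m" "[:l - s * of_nat m, - s:]"]
    by (simp split: if_splits)
qed (simp add: affine_product_def)

lemma coeff_affine_product: "coeff (affine_product l s m) m = (- s) ^ m"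
proof (induction m)
  case (Suc m)
  have "affine_product l s (Suc m) = [:l - s * of_nat m, - s:] * affine_product l s m"
    by (simp add: affine_product_def mult.commute)
  moreover have "coeff (affine_product l s m) (Suc m) = 0"
    using degree_affine_product_le[of l s m] by (intro coeff_eq_0) simp
  ultimately show ?case
    using Suc by simp
qed (simp add: affine_product_def)

lemma poly_eq_on_naturals:
  fixes p q :: "'a::field poly"
  assumes char: "CHAR('a) = 0" and eq: "\<And>k. poly p (of_nat k) = poly q (of_nat k)"
  shows "p = q"
proof (rule ccontr)
  assume "p \<noteq> q"
  then have "finite {x. poly (p - q) x = 0}" by (intro poly_roots_finite) simp
  moreover have "range (of_nat :: nat \<Rightarrow> 'a) \<subseteq> {x. poly (p - q) x = 0}"
    using eq by auto
  ultimately have "finite (range (of_nat :: nat \<Rightarrow> 'a))" by (rule finite_subset[rotated])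
  moreover have "inj (of_nat :: nat \<Rightarrow> 'a)"
  proof (rule linorder_injI)
    show "of_nat m \<noteq> (of_nat n :: 'a)" if "m < n" for m n
      using that char by (simp add: of_nat_eq_iff_char_dvd)
  qed
  ultimately show False using finite_imageD infinite_UNIV_nat by blast
qed

text \<open>
  Subtract the contribution of \<open>g\<^sub>0 = 1\<close> from the coefficient of \<open>y\<^sup>n\<^sup>+\<^sup>1\<close> in the recurrence.  Both
  sides are then polynomials in \<open>k\<close> of degree at most \<open>n\<close>: on the left,
  \<open>\<gamma>\<^sub>k\<^sub>+\<^sub>1 \<dots> \<gamma>\<^sub>k\<^sub>+\<^sub>n\<^sub>+\<^sub>1 - \<gamma>\<^sub>k \<dots> \<gamma>\<^sub>k\<^sub>+\<^sub>n\<close> is \<open>\<gamma>\<^sub>k\<^sub>+\<^sub>1 \<dots> \<gamma>\<^sub>k\<^sub>+\<^sub>n\<close> times \<open>-s (n+1)\<close>.  Only the coefficient of \<open>y\<close> in \<open>g\<close> contributes to \<open>k\<^sup>n\<close> on the right-hand side, so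
  comparing the coefficients of \<open>k\<^sup>n\<close> eliminates the higher ones.
\<close>

lemma twisted_ratio_parameter_recurrence:
  fixes g :: "'a::field fps"
  assumes ratio: "\<And>k. twisted_series \<gamma> c (Suc k) = g * twisted_series \<gamma> c k" and c0: "c 0 \<noteq> 0"
    and \<gamma>: "\<And>k. \<gamma> k = l - s * of_nat k" and s: "s \<noteq> 0"
    and char: "CHAR('a) = 0"
  shows "- s * of_nat (Suc n) * c (Suc n) = fps_nth g 1 * c n"
proof -
  let ?L = "smult (- s * of_nat (Suc n) * c (Suc n)) (affine_product (l - s) s n)"
  let ?R = "\<Sum>j\<le>n. smult (fps_nth g (Suc j) * c (n - j)) (affine_product l s (n - j))"
  have "?L = ?R"
  proof (rule poly_eq_on_naturals[OF char])
    fix k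
    define P where "P = (\<Prod>i<n. \<gamma> (Suc k + i))"
    have P: "poly (affine_product (l - s) s n) (of_nat k) = P"
      unfolding poly_affine_product P_def by (simp add: \<gamma> algebra_simps)
    have Q: "poly (affine_product l s m) (of_nat k) = (\<Prod>i<m. \<gamma> (k + i))" for m
      unfolding poly_affine_product by (simp add: \<gamma>)
    have new: "(\<Prod>i<Suc n. \<gamma> (Suc k + i)) = P * \<gamma> (Suc k + n)"
      by (simp add: P_def)
    have old: "(\<Prod>i<Suc n. \<gamma> (k + i)) = \<gamma> k * P"
      unfolding prod.lessThan_Suc_shift P_def by simp
    have "fps_nth (twisted_series \<gamma> c (Suc k)) (Suc n)
        = (\<Sum>j\<le>Suc n. fps_nth g j * fps_nth (twisted_series \<gamma> c k) (Suc n - j))"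
      by (simp only: ratio fps_mult_nth atLeast0AtMost)
    also have "\<dots> = fps_nth (twisted_series \<gamma> c k) (Suc n)
        + (\<Sum>j\<le>n. fps_nth g (Suc j) * fps_nth (twisted_series \<gamma> c k) (n - j))"
      by (simp only: sum.atMost_Suc_shift twisted_ratio_nth_0[OF ratio c0]) simp
    finally have "P * \<gamma> (Suc k + n) * c (Suc n) = \<gamma> k * P * c (Suc n) + poly ?R (of_nat k)"
      unfolding twisted_series_nth new old by (simp add: poly_sum Q mult_ac)
    moreover have "\<gamma> (Suc k + n) = \<gamma> k - s * of_nat (Suc n)"
      by (simp add: \<gamma> algebra_simps)
    ultimately have "poly ?R (of_nat k) = P * (\<gamma> k - s * of_nat (Suc n)) * c (Suc n) - \<gamma> k * P * c (Suc n)"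
      by simp
    then show "poly ?L (of_nat k) = poly ?R (of_nat k)"
      unfolding poly_smult P by (simp only:) (simp add: algebra_simps del: of_nat_Suc)
  qed
  then have "coeff ?L n = coeff ?R n" by simp
  moreover have "coeff ?R n = fps_nth g 1 * c n * (- s) ^ n"
  proof -
    have "coeff (affine_product l s (n - Suc j)) n = 0" if "j < n" for j
      using degree_affine_product_le[of l s "n - Suc j"] that by (intro coeff_eq_0) simp
    then have "(\<Sum>j<n. fps_nth g (Suc (Suc j)) * c (n - Suc j) *
        coeff (affine_product l s (n - Suc j)) n) = 0"
      by (intro sum.neutral) simp
    then show ?thesis
      by (simp add: coeff_sum sum.atMost_shift coeff_affine_product)
  qed
  ultimately have "(- s * of_nat (Suc n) * c (Suc n)) * (- s) ^ n = (fps_nth g 1 * c n) * (- s) ^ n"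
    by (simp only: coeff_smult coeff_affine_product)
  moreover have "(- s) ^ n \<noteq> 0" using s by simp
  ultimately show ?thesis by (metis mult_right_cancel)
qed

lemma exponential_recurrence:
  fixes c :: "nat \<Rightarrow> 'a::field"
  assumes char: "CHAR('a) = 0" and rec: "\<And>n. of_nat (Suc n) * c (Suc n) = h * c n"
  shows "c n = c 0 * (h ^ n / of_nat (fact n))"
proof (induction n)
  case (Suc n)
  have "of_nat (Suc n) \<noteq> (0::'a)"
    using char by (simp only: of_nat_eq_0_iff_char_dvd) simp
  then have "c (Suc n) = h * c n / of_nat (Suc n)"
    using rec[of n] by (simp add: field_simps del: of_nat_Suc)
  then show ?case
    unfolding fact_Suc of_nat_mult of_nat_id by (simp add: Suc mult_ac del: of_nat_Suc)
qed simp

text \<open>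
  The coefficient of \<open>y\<close> makes \<open>\<gamma>\<close> affine with slope \<open>g\<^sub>1 c\<^sub>0 / c\<^sub>1\<close>.  If this is non-zero, then
  \<open>g \<noteq> 1\<close>, which excludes prime characteristic, and cancelling the slope in the recurrence for
  \<open>c\<close> leaves the exponential with \<open>h = c\<^sub>1 / c\<^sub>0\<close>.
\<close>

lemma twisted_ratio_imp_affine_exp:
  fixes \<gamma> :: "nat \<Rightarrow> 'a::field"
  assumes ratio: "\<And>k. twisted_series \<gamma> c (Suc k) = g * twisted_series \<gamma> c k"
    and c0: "c 0 \<noteq> 0" and c1: "c 1 \<noteq> 0"
  obtains "\<And>k. \<gamma> k = \<gamma> 0"
  | s h where "CHAR('a) = 0" "s \<noteq> 0" "\<And>k. \<gamma> k = \<gamma> 0 - s * of_nat k"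
      "\<And>n. c n = c 0 * (h ^ n / of_nat (fact n))"
proof -
  define s where "s = - (fps_nth g 1 * c 0 / c 1)"
  have "\<gamma> (Suc k) = \<gamma> k - s" for k
    using twisted_ratio_nth_1[OF ratio c0, of k] c1 by (simp add: s_def field_simps)
  then have \<gamma>: "\<gamma> k = \<gamma> 0 - s * of_nat k" for k
    by (rule affine_of_constant_difference)
  show thesis
  proof (cases "s = 0")
    case True
    then show thesis using \<gamma> that(1) by simp
  next
    case False
    have "g \<noteq> 1" using False by (auto simp: s_def)
    then have char: "CHAR('a) = 0"
      using twisted_ratio_prime_char[OF ratio c0 \<gamma>] by auto
    have "of_nat (Suc n) * c (Suc n) = (c 1 / c 0) * c n" for n
    proof -
      have g1: "fps_nth g 1 = - s * (c 1 / c 0)"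
        using c0 c1 by (simp add: s_def)
      have "- s * (of_nat (Suc n) * c (Suc n)) = - s * ((c 1 / c 0) * c n)"
        using twisted_ratio_parameter_recurrence[OF ratio c0 \<gamma> False char, of n]
        unfolding g1 by (simp only: mult.assoc)
      then show ?thesis
        using False by (metis mult_left_cancel neg_equal_0_iff_equal)
    qed
    then have "c n = c 0 * ((c 1 / c 0) ^ n / of_nat (fact n))" for n
      by (rule exponential_recurrence[OF char])
    then show thesis using that(2) char False \<gamma> by blast
  qed
qed

section \<open>The characterisation\<close>

theorem theorem5p4:
  fixes w w' c \<gamma> :: "nat \<Rightarrow> 'a::field"
    and W W' \<alpha> :: "'a fps"
    and A :: "nat \<Rightarrow> nat \<Rightarrow> 'a"
  assumes "W = Abs_fps (\<lambda>n. 1 / w n)" and "w 0 = 1" and "\<forall>n. w n \<noteq> 0"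
    and "A \<in> riordan_arrays W"
    and "W_appell W (graded_sequence A)"
    and "appell_parameter W (graded_sequence A) = \<alpha>"
    and "\<alpha> = Abs_fps c" and "c 0 \<noteq> 0"
    and "W' = Abs_fps (\<lambda>n. 1 / w' n)" and "w' 0 = 1" and "\<forall>n. w' n \<noteq> 0"
    and "\<forall>k. \<gamma> k = (w' k * w (Suc k)) / (w' (Suc k) * w k)"
  shows "((\<exists>r. r \<noteq> 0 \<and> (\<forall>k. \<gamma> k = r)) \<longrightarrow> A \<in> riordan_arrays W') \<and>
    (CHAR('a) = 0 \<and>
      (\<exists>l s. s \<noteq> 0 \<and> (\<forall>k. \<gamma> k = l - s * of_nat k \<and> \<gamma> k \<noteq> 0)) \<and>
      (\<exists>h. \<alpha> = fps_const (c 0) * fps_exp h) \<longrightarrow> A \<in> riordan_arrays W') \<and>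
    (c 1 \<noteq> 0 \<longrightarrow> A \<in> riordan_arrays W' \<longrightarrow>
      (\<exists>r. r \<noteq> 0 \<and> (\<forall>k. \<gamma> k = r)) \<or>
      (CHAR('a) = 0 \<and>
        (\<exists>l s. s \<noteq> 0 \<and> (\<forall>k. \<gamma> k = l - s * of_nat k \<and> \<gamma> k \<noteq> 0)) \<and>
        (\<exists>h. \<alpha> = fps_const (c 0) * fps_exp h)))"
proof -
  have wc: "weight_coeff W n = w n" "weight_coeff W' n = w' n" for n
    using assms(1,9) by (simp_all add: weight_coeff_def)
  have low: "A \<in> lower_triangular_group"
    using assms(4) by (simp add: riordan_arrays_def)
  have entry: "A (k + m) k = w (k + m) / w k * c m" for k m
    using W_appell_entry[OF assms(5) low, of k m] assms(2,3,6,7) by (simp add: wc)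
  have riordan: "A \<in> riordan_arrays W' \<longleftrightarrow>
      (\<exists>g. \<forall>k. twisted_series \<gamma> c (Suc k) = g * twisted_series \<gamma> c k)"
    by (rule riordan_iff_twisted_ratio[where w = w and w' = w', OF low entry])
      (use assms(3,8,11,12) wc in auto)
  have \<gamma>_nz: "\<gamma> k \<noteq> 0" for k
    using assms(3,11,12) by simp
  have exp_iff: "\<alpha> = fps_const (c 0) * fps_exp h \<longleftrightarrow>
      (\<forall>n. c n = c 0 * (h ^ n / of_nat (fact n)))" for h
    by (simp add: assms(7) fps_eq_iff)
  show ?thesis
  proof (intro conjI impI)
    assume "\<exists>r. r \<noteq> 0 \<and> (\<forall>k. \<gamma> k = r)"
    then have "twisted_series \<gamma> c (Suc k) = 1 * twisted_series \<gamma> c k" for k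
      by (auto simp: twisted_series_def)
    then show "A \<in> riordan_arrays W'"
      unfolding riordan by blast
  next
    assume "CHAR('a) = 0 \<and>
      (\<exists>l s. s \<noteq> 0 \<and> (\<forall>k. \<gamma> k = l - s * of_nat k \<and> \<gamma> k \<noteq> 0)) \<and>
      (\<exists>h. \<alpha> = fps_const (c 0) * fps_exp h)"
    then show "A \<in> riordan_arrays W'"
      unfolding riordan exp_iff using affine_exp_imp_twisted_ratio by blast
  next
    assume c1: "c 1 \<noteq> 0" and "A \<in> riordan_arrays W'"
    then obtain g where ratio: "\<And>k. twisted_series \<gamma> c (Suc k) = g * twisted_series \<gamma> c k"
      unfolding riordan by blast
    show "(\<exists>r. r \<noteq> 0 \<and> (\<forall>k. \<gamma> k = r)) \<or>
      (CHAR('a) = 0 \<and>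
        (\<exists>l s. s \<noteq> 0 \<and> (\<forall>k. \<gamma> k = l - s * of_nat k \<and> \<gamma> k \<noteq> 0)) \<and>
        (\<exists>h. \<alpha> = fps_const (c 0) * fps_exp h))"
    proof (rule twisted_ratio_imp_affine_exp[OF ratio assms(8) c1])
      assume "\<And>k. \<gamma> k = \<gamma> 0"
      then have "\<gamma> 0 \<noteq> 0 \<and> (\<forall>k. \<gamma> k = \<gamma> 0)"
        using \<gamma>_nz by simp
      then show ?thesis by blast
    next
      fix s h
      assume "CHAR('a) = 0" and s: "s \<noteq> 0" and aff: "\<And>k. \<gamma> k = \<gamma> 0 - s * of_nat k"
        and exp: "\<And>n. c n = c 0 * (h ^ n / of_nat (fact n))"
      moreover have "\<exists>l s. s \<noteq> 0 \<and> (\<forall>k. \<gamma> k = l - s * of_nat k \<and> \<gamma> k \<noteq> 0)"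
        by (intro exI[of _ "\<gamma> 0"] exI[of _ s] conjI allI s aff \<gamma>_nz)
      moreover have "\<alpha> = fps_const (c 0) * fps_exp h"
        unfolding exp_iff by (intro allI exp)
      ultimately show ?thesis by blast
    qed
  qed
qed

end
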